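(* Let $K\ge 1$, let $\mathcal V$ be a finite vocabulary, let $\mathcal M_0,\dots,\mathcal M_K$ be any language models over $\mathcal V$, where $\mathcal M_K$ is the target model, and let $T_0,\dots,T_{K-1}$ be any positive integers. Then the output distribution of the Hierarchical Speculative Decoding procedure $\mathrm{HSD}(K,c)$ follows that of the target model $\mathcal M_K$. That is, for every context $c$, if $(y_1,\dots,y_N)$ denotes the random sequence (of random length $N$) of tokens returned by $\mathrm{HSD}(K,c)$, then for every $i\ge 1$ and every $y_1,\dots,y_{i-1}\in\mathcal V$ such that the event that $N\ge i$ and the first $i-1$ returned tokens are $y_1,\dots,y_{i-1}$ has positive probability, the conditional law of the $i$-th returned token given this event is $\mathcal M_K(\cdot\mid c+y_1\cdots y_{i-1})$, the next-token distribution of $\mathcal M_K$.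
   Context: A language model $\mathcal M$ over a finite vocabulary $\mathcal V$ assigns to every finite token sequence (context) $c$ a probability distribution $\mathcal M(\cdot\mid c)$ on $\mathcal V$. The symbol $+$ denotes concatenation of token sequences. All random draws below use fresh independent randomness. Procedure $\mathrm{Verify}(k,(x_1,\dots,x_t),(q_1,\dots,q_t),c)$: here $x_1,\dots,x_t\in\mathcal V$ are draft tokens and $q_1,\dots,q_t$ are probability distributions on $\mathcal V$. Compute $p_i=\mathcal M_k(\cdot\mid c+x_1\cdots x_{i-1})$ for $i=1,\dots,t+1$. For $i=1,2,\dots,t$ in order, draw $r$ uniform on $(0,1)$; if $r>p_i(x_i)/q_i(x_i)$, then set $n=i-1$ and stop the loop (token $x_i$ is rejected). If no token is rejected, set $n=t$. If $n=t$, draw $m\sim p_{t+1}$. If $n<t$, draw $m$ from the distribution on $\mathcal V$ proportional to $x\mapsto\max\{0,p_{n+1}(x)-q_{n+1}(x)\}$. Return the tokens $(x_1,\dots,x_n,m)$ together with the distributions $(p_1,\dots,p_{n+1})$. Procedure $\mathrm{HSD}(k,c)$ for $0\le k\le K$ returns a list of tokens and a list of distributions of the same length: (1) If $k=0$: generate $T_0$ tokens autoregressively from $\mathcal M_0$, i.e. $x_i\sim q_i:=\mathcal M_0(\cdot\mid c+x_1\cdots x_{i-1})$ for $i=1,\dots,T_0$; return $(x_1,\dots,x_{T_0})$ and $(q_1,\dots,q_{T_0})$. (2) If $k=K$: let $(\mathbf x,\mathbf q)$ be the output of $\mathrm{HSD}(K-1,c)$; return $\mathrm{Verify}(K,\mathbf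 x,\mathbf q,c)$. (3) If $0<k<K$: start with empty lists tokens and probs. While the length of tokens is less than $T_k$: let $(\mathbf x,\mathbf q)$ be the output of $\mathrm{HSD}(k-1,c+\text{tokens})$, let $(\mathbf y,\mathbf p)$ be the output of $\mathrm{Verify}(k,\mathbf x,\mathbf q,c+\text{tokens})$, and append $\mathbf y$ to tokens and $\mathbf p$ to probs. Return tokens and probs. *)

theory Defs
  imports "HOL-Probability.Probability"
begin

text \<open>The vocabulary is a finite type \<open>'v\<close>. A context is a token list, and \<open>@\<close> is concatenation.\<close>

type_synonym 'v language_model = "'v list \<Rightarrow> 'v pmf"

text \<open>
  Law of the outcome of one test: \<open>r\<close> is uniform on the open unit interval and the token is
  rejected iff \<open>r > p x / q x\<close>. Only the resulting bit is kept, since \<open>r\<close> is used nowhere else and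
  the remaining randomness is discrete. The value at \<open>q x = 0\<close> is immaterial: such a token is
  drafted with probability \<open>0\<close>.
\<close>

definition accept_test :: "'v pmf \<Rightarrow> 'v pmf \<Rightarrow> 'v \<Rightarrow> bool pmf" where
  "accept_test p q x =
     bernoulli_pmf \<P>(r in uniform_measure lborel {0<..<1::real}. \<not> r > pmf p x / pmf q x)"

primrec accepted_length :: "('v pmf \<times> 'v \<times> 'v pmf) list \<Rightarrow> nat pmf" where
  "accepted_length [] = return_pmf 0"
| "accepted_length (a # as) = (case a of (p, x, q) \<Rightarrow>
     do {
       accepted \<leftarrow> accept_test p q x;
       if accepted then map_pmf Suc (accepted_length as) else return_pmf 0
     })"

text \<open>
  For \<open>p = q\<close> the normalising constant is \<open>0\<close> and the result is an unspecified distribution. It is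
  then never sampled, because a token drafted from \<open>q\<close> is accepted almost surely.
\<close>

definition residual :: "'v::finite pmf \<Rightarrow> 'v pmf \<Rightarrow> 'v pmf" where
  "residual p q = embed_pmf (\<lambda>x. max 0 (pmf p x - pmf q x) / (\<Sum>y\<in>UNIV. max 0 (pmf p y - pmf q y)))"

text \<open>
  Lists are indexed from \<open>0\<close>, so \<open>ps ! i\<close> is the distribution following the first \<open>i\<close> draft tokens.
  The list \<open>ps\<close> has one entry more than \<open>xs\<close>, and \<open>zip\<close> drops that last entry.
\<close>

definition verify ::
  "'v::finite language_model \<Rightarrow> 'v list \<Rightarrow> 'v pmf list \<Rightarrow> 'v list \<Rightarrow> ('v list \<times> 'v pmf list) pmf" where
  "verify \<M> xs qs c =
     (let t = length xs; ps = map (\<lambda>i. \<M> (c @ take i xs)) [0..<Suc t] in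
      do {
        n \<leftarrow> accepted_length (zip ps (zip xs qs));
        m \<leftarrow> (if n = t then ps ! n else residual (ps ! n) (qs ! n));
        return_pmf (take n xs @ [m], take (Suc n) ps)
      })"

lemma verify_nonempty: "(ys, ps) \<in> set_pmf (verify \<M> xs qs c) \<Longrightarrow> ys \<noteq> []"
  by (auto simp: verify_def Let_def)

primrec autoregress ::
  "'v language_model \<Rightarrow> nat \<Rightarrow> 'v list \<Rightarrow> ('v list \<times> 'v pmf list) pmf" where
  "autoregress \<M> 0 c = return_pmf ([], [])"
| "autoregress \<M> (Suc n) c =
     do {
       x \<leftarrow> \<M> c;
       (xs, qs) \<leftarrow> autoregress \<M> n (c @ [x]);
       return_pmf (x # xs, \<M> c # qs)
     }"

text \<open>
  The while loop at an intermediate level, started from the given tokens and distributions. It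
  terminates because \<open>verify\<close> always returns at least one token.
\<close>

function hsd_loop ::
  "'v::finite language_model \<Rightarrow> ('v list \<Rightarrow> ('v list \<times> 'v pmf list) pmf) \<Rightarrow> nat \<Rightarrow> 'v list \<Rightarrow>
     'v list \<Rightarrow> 'v pmf list \<Rightarrow> ('v list \<times> 'v pmf list) pmf" where
  "hsd_loop \<M> draft T c tokens probs =
     (if length tokens < T then
        do {
          (xs, qs) \<leftarrow> draft (c @ tokens);
          (ys, ps) \<leftarrow> verify \<M> xs qs (c @ tokens);
          hsd_loop \<M> draft T c (tokens @ ys) (probs @ ps)
        }
      else return_pmf (tokens, probs))"
  by pat_completeness auto
termination
  by (relation "Wellfounded.measure (\<lambda>(\<M>, draft, T, c, tokens, probs). T - length tokens)")
     (auto dest!: verify_nonempty intro!: diff_less_mono2)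

declare hsd_loop.simps [simp del]

text \<open>\<open>hsd K \<M> T k c\<close>, for \<open>k \<le> K\<close>; the models are \<open>\<M> 0, \<dots>, \<M> K\<close> with target \<open>\<M> K\<close>.\<close>

fun hsd ::
  "nat \<Rightarrow> (nat \<Rightarrow> 'v::finite language_model) \<Rightarrow> (nat \<Rightarrow> nat) \<Rightarrow> nat \<Rightarrow> 'v list \<Rightarrow>
     ('v list \<times> 'v pmf list) pmf" where
  "hsd K \<M> T 0 c = autoregress (\<M> 0) (T 0) c"
| "hsd K \<M> T (Suc j) c =
     (if Suc j = K then
        do {
          (xs, qs) \<leftarrow> hsd K \<M> T j c;
          verify (\<M> K) xs qs c
        }
      else hsd_loop (\<M> (Suc j)) (hsd K \<M> T j) (T (Suc j)) c [] [])"

definition hsd_output ::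
  "nat \<Rightarrow> (nat \<Rightarrow> 'v::finite language_model) \<Rightarrow> (nat \<Rightarrow> nat) \<Rightarrow> 'v list \<Rightarrow> 'v list pmf" where
  "hsd_output K \<M> T c = map_pmf fst (hsd K \<M> T K c)"

end

theory Submission
  imports Defs "HOL-Library.Sublist"
begin

text \<open>
  Drawing \<open>x\<close> from \<open>q\<close> and then keeping it or resampling from the residual yields an exact draw
  from \<open>p\<close>. The returned sequence has random length, so the invariant of each level is: for every
  \<open>ys\<close>, conditioned on the sequence starting with \<open>ys\<close> and going on, the next token has law
  \<open>\<M> (c @ ys)\<close>. Verification turns this invariant for the draft model into the one for the verifying
  model: given that \<open>ys\<close> was drafted and accepted, either the draft ends there and the next token is
  drawn from \<open>\<M> (c @ ys)\<close>, or it goes on and the next token results from a speculative draw.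
  Concatenation also preserves the invariant, even when the random first part decides how to
  continue, which covers the loops of the intermediate levels.
\<close>

subsection \<open>A single speculative draw\<close>

lemma pmf_accept_test:
  "pmf (accept_test p q x) True = min 1 (pmf p x / pmf q x)"
proof -
  define s where "s = pmf p x / pmf q x"
  have "s \<ge> 0" by (simp add: s_def)
  have "{0<..<1::real} \<inter> {r. \<not> r > s} = (if s < 1 then {0<..s} else {0<..<1})"
    by auto
  then have "\<P>(r in uniform_measure lborel {0<..<1::real}. \<not> r > s) = min 1 s"
    using \<open>s \<ge> 0\<close> by (simp add: measure_uniform_measure)
  then show ?thesis
    using \<open>s \<ge> 0\<close> by (simp add: accept_test_def s_def)
qed

lemma pmf_bool_False: "pmf b False = 1 - pmf b True"
proof -
  have "(\<Sum>x\<in>UNIV. pmf b x) = 1" by (rule sum_pmf_eq_1) auto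
  then show ?thesis by (simp add: UNIV_bool)
qed

lemma pmf_bind_bool:
  "pmf (bind_pmf b f) x = pmf b True * pmf (f True) x + (1 - pmf b True) * pmf (f False) x"
  by (simp add: pmf_bind integral_measure_pmf[where A=UNIV] UNIV_bool pmf_bool_False)

lemma emeasure_bind_bool:
  "emeasure (bind_pmf b f) A =
     ennreal (pmf b True) * emeasure (f True) A + ennreal (pmf b False) * emeasure (f False) A"
  by (simp add: emeasure_bind_pmf nn_integral_measure_pmf nn_integral_count_space_finite UNIV_bool
      add.commute)

text \<open>One position in isolation: what verification puts where \<open>x\<close> was drafted.
  Averaging over the draft is postponed until the law of the draft is known.\<close>

definition speculative_step :: "'v::finite pmf \<Rightarrow> 'v pmf \<Rightarrow> 'v \<Rightarrow> 'v pmf" where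
  "speculative_step p q x =
     bind_pmf (accept_test p q x) (\<lambda>accepted. if accepted then return_pmf x else residual p q)"

lemma pmf_residual:
  fixes p q :: "'v::finite pmf"
  assumes "(\<Sum>y\<in>UNIV. max 0 (pmf p y - pmf q y)) > 0"
  shows "pmf (residual p q) x =
    max 0 (pmf p x - pmf q x) / (\<Sum>y\<in>UNIV. max 0 (pmf p y - pmf q y))"
  unfolding residual_def
proof (rule pmf_embed_pmf)
  let ?Z = "\<Sum>y\<in>UNIV. max 0 (pmf p y - pmf q y)"
  have "(\<Sum>x\<in>UNIV. ennreal (max 0 (pmf p x - pmf q x) / ?Z)) =
      ennreal (\<Sum>x\<in>UNIV. max 0 (pmf p x - pmf q x) / ?Z)"
    by (rule sum_ennreal) (use assms in auto)
  also have "(\<Sum>x\<in>UNIV. max 0 (pmf p x - pmf q x) / ?Z) = 1"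
    using assms by (simp flip: sum_divide_distrib)
  finally show "(\<integral>\<^sup>+x. ennreal (max 0 (pmf p x - pmf q x) / ?Z) \<partial>count_space UNIV) = 1"
    by (simp add: nn_integral_count_space_finite)
qed (use assms in auto)

text \<open>Accepted drafts contribute \<open>min (pmf p x) (pmf q x)\<close>. The total rejected
  mass equals the normalising constant of the residual, so the two cancel and rejection contributes
  the missing \<open>max 0 (pmf p x - pmf q x)\<close>.\<close>

lemma bind_speculative_step: "bind_pmf q (speculative_step p q) = p"
proof (rule pmf_eqI)
  fix x
  define a where "a z = min 1 (pmf p z / pmf q z)" for z
  define Z where "Z = (\<Sum>y\<in>UNIV. max 0 (pmf p y - pmf q y))"
  have qa: "pmf q z * a z = min (pmf p z) (pmf q z)" for z
    by (cases "pmf q z = 0") (auto simp: a_def min_def field_simps)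
  have sums: "(\<Sum>z\<in>UNIV. pmf p z) = 1" "(\<Sum>z\<in>UNIV. pmf q z) = 1"
    by (auto intro: sum_pmf_eq_1)
  have "(\<Sum>z\<in>UNIV. pmf q z * (1 - a z)) = (\<Sum>z\<in>UNIV. pmf q z - min (pmf p z) (pmf q z))"
    by (simp add: right_diff_distrib qa)
  \<comment> \<open>The added differences \<open>pmf q z - pmf p z\<close> sum to 0, both laws
    having total mass 1.\<close>
  also have "\<dots> = (\<Sum>z\<in>UNIV. max 0 (pmf p z - pmf q z) + (pmf q z - pmf p z))"
    by (rule sum.cong) auto
  also have "\<dots> = Z"
    by (simp add: sum.distrib sum_subtractf sums Z_def)
  finally have rejected: "(\<Sum>z\<in>UNIV. pmf q z * (1 - a z)) = Z" .
  have "Z \<ge> 0" by (auto simp: Z_def intro: sum_nonneg)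
  have "pmf (bind_pmf q (speculative_step p q)) x =
      (\<Sum>z\<in>UNIV. pmf q z * (a z * indicator {x} z + (1 - a z) * pmf (residual p q) x))"
    by (auto simp: pmf_bind[of q] integral_measure_pmf[where A=UNIV] speculative_step_def
        pmf_bind_bool pmf_accept_test a_def indicator_def intro!: sum.cong)
  also have "\<dots> = (\<Sum>z\<in>UNIV. indicator {x} z * (pmf q z * a z)) +
      (\<Sum>z\<in>UNIV. pmf q z * (1 - a z)) * pmf (residual p q) x"
    by (simp add: sum.distrib sum_distrib_left distrib_left mult_ac)
  also have "\<dots> = min (pmf p x) (pmf q x) + Z * pmf (residual p q) x"
    by (simp add: rejected qa)
  also have "Z * pmf (residual p q) x = max 0 (pmf p x - pmf q x)"
  \<comment> \<open>If \<open>Z = 0\<close> the residual is unspecified, but then \<open>p\<close>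
    nowhere exceeds \<open>q\<close> and both sides vanish.\<close>
  proof (cases "Z = 0")
    case True
    then have "max 0 (pmf p x - pmf q x) = 0"
      by (simp add: Z_def sum_nonneg_eq_0_iff)
    with True show ?thesis by simp
  next
    case False
    with \<open>Z \<ge> 0\<close> show ?thesis by (simp add: Z_def pmf_residual)
  qed
  finally show "pmf (bind_pmf q (speculative_step p q)) x = pmf p x" by simp
qed


subsection \<open>Random continuations of a context\<close>

text \<open>
  The event \<open>strict_prefix ys zs\<close> says that \<open>zs\<close> starts with \<open>ys\<close> and has a further token, so this
  is the conditional law of the next token with the division cleared.
\<close>

definition follows :: "'v language_model \<Rightarrow> 'v list \<Rightarrow> 'v list pmf \<Rightarrow> bool" where
  "follows M c D \<longleftrightarrow> (\<forall>ys x. emeasure D {zs. prefix (ys @ [x]) zs} =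
     emeasure D {zs. strict_prefix ys zs} * ennreal (pmf (M (c @ ys)) x))"

lemma follows_return_Nil: "follows M c (return_pmf [])"
  by (simp add: follows_def)

lemma follows_singleton: "follows M c (map_pmf (\<lambda>x. [x]) (M c))"
  unfolding follows_def
proof (intro allI)
  fix ys :: "'a list" and x
  show "emeasure (map_pmf (\<lambda>x. [x]) (M c)) {zs. prefix (ys @ [x]) zs} =
     emeasure (map_pmf (\<lambda>x. [x]) (M c)) {zs. strict_prefix ys zs} * ennreal (pmf (M (c @ ys)) x)"
  proof (cases ys)
    case Nil
    have "{z. x = z} = {x}" by auto
    with Nil show ?thesis
      by (simp add: vimage_def emeasure_pmf_single measure_pmf.emeasure_space_1[simplified])
  next
    case (Cons y ys')
    then have "(\<lambda>x. [x]) -` {zs. prefix (ys @ [x]) zs} = {}"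
      "(\<lambda>x. [x]) -` {zs. strict_prefix ys zs} = {}"
      by (auto simp: strict_prefix_def)
    then show ?thesis by simp
  qed
qed

text \<open>A first part reaching beyond \<open>ys\<close> already decides the event, and the
  property of \<open>D\<close> applies. One that stops at or before \<open>ys\<close> leaves the
  decision to \<open>E xs\<close>, whose context \<open>c @ xs\<close> is extended by the rest of
  \<open>ys\<close> to the same \<open>c @ ys\<close>. Hence both contributions carry the same
  factor.\<close>

lemma follows_bind_append:
  assumes D: "follows M c D" and E: "\<And>xs. xs \<in> set_pmf D \<Longrightarrow> follows M (c @ xs) (E xs)"
  shows "follows M c (bind_pmf D (\<lambda>xs. map_pmf ((@) xs) (E xs)))"
  unfolding follows_def
proof (intro allI)
  fix ys :: "'a list" and x
  let ?F = "\<lambda>xs. map_pmf ((@) xs) (E xs)"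
  let ?m = "ennreal (pmf (M (c @ ys)) x)"
  let ?r = "\<lambda>xs. if prefix xs ys then emeasure (E xs) {zs. strict_prefix (drop (length xs) ys) zs} else 0"
  have strict: "emeasure (?F xs) {zs. strict_prefix ys zs} =
      indicator {zs. strict_prefix ys zs} xs + ?r xs" for xs
  proof -
    consider (ext) "strict_prefix ys xs" | (pre) ds where "ys = xs @ ds" | (par) "ys \<parallel> xs"
      by (metis prefixE prefix_order.le_less parallel_def)
    then show ?thesis
    proof cases
      case ext
      then have "((@) xs) -` {zs. strict_prefix ys zs} = UNIV" "\<not> prefix xs ys"
        by (auto simp: strict_prefix_def)
      with ext show ?thesis by (simp add: measure_pmf.emeasure_space_1[simplified])
    next
      case pre
      then have "((@) xs) -` {zs. strict_prefix ys zs} = {zs. strict_prefix ds zs}"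
        "\<not> strict_prefix ys xs"
        by (auto simp: strict_prefix_def)
      with pre show ?thesis by simp
    next
      case par
      then have "\<not> prefix ys (xs @ zs)" for zs
        by (auto simp: parallel_def dest: prefix_same_cases[OF _ prefixI[OF refl]])
      with par show ?thesis by (simp add: parallel_def strict_prefix_def)
    qed
  qed
  have snoc: "emeasure (?F xs) {zs. prefix (ys @ [x]) zs} =
      indicator {zs. prefix (ys @ [x]) zs} xs + ?r xs * ?m" if "xs \<in> set_pmf D" for xs
  proof -
    \<comment> \<open>Case \<open>par\<close> also covers an \<open>xs\<close> that extends
      \<open>ys\<close> by a token other than \<open>x\<close>.\<close>
    consider (ext) "prefix (ys @ [x]) xs" | (pre) ds where "ys = xs @ ds"
      | (par) "\<not> prefix (ys @ [x]) xs" "\<not> prefix xs ys"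
      by (metis prefixE)
    then show ?thesis
    proof cases
      case ext
      then have "((@) xs) -` {zs. prefix (ys @ [x]) zs} = UNIV" "\<not> prefix xs ys"
        using prefix_length_le[of xs ys] prefix_length_le[of "ys @ [x]" xs] by auto
      with ext show ?thesis by (simp add: measure_pmf.emeasure_space_1[simplified])
    next
      case pre
      then have "((@) xs) -` {zs. prefix (ys @ [x]) zs} = {zs. prefix (ds @ [x]) zs}"
        "\<not> prefix (ys @ [x]) xs"
        by (auto dest: prefix_length_le)
      with pre E[OF that] show ?thesis by (simp add: follows_def)
    next
      case par
      then have "((@) xs) -` {zs. prefix (ys @ [x]) zs} = {}"
        by (auto dest: prefix_same_cases[OF _ prefixI[OF refl]])
      with par show ?thesis by simp
    qed
  qed
  have "emeasure (bind_pmf D ?F) {zs. prefix (ys @ [x]) zs} =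
      (\<integral>\<^sup>+xs. indicator {zs. prefix (ys @ [x]) zs} xs + ?r xs * ?m \<partial>D)"
    unfolding emeasure_bind_pmf
    by (intro nn_integral_cong_AE AE_pmfI snoc)
  also have "\<dots> = emeasure D {zs. prefix (ys @ [x]) zs} + (\<integral>\<^sup>+xs. ?r xs \<partial>D) * ?m"
    by (simp add: nn_integral_add nn_integral_multc)
  also have "\<dots> = (emeasure D {zs. strict_prefix ys zs} + (\<integral>\<^sup>+xs. ?r xs \<partial>D)) * ?m"
    using D by (simp add: follows_def distrib_right)
  also have "\<dots> = emeasure (bind_pmf D ?F) {zs. strict_prefix ys zs} * ?m"
    unfolding emeasure_bind_pmf strict by (simp add: nn_integral_add)
  finally show "emeasure (bind_pmf D ?F) {zs. prefix (ys @ [x]) zs} =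
      emeasure (bind_pmf D ?F) {zs. strict_prefix ys zs} * ?m" .
qed

text \<open>Positive probability of the conditioning event permits the division that
  \<open>follows\<close> avoids.\<close>

lemma follows_imp_cond:
  assumes "follows M c D" and pos: "measure_pmf.prob D {zs. strict_prefix ys zs} > 0"
  shows "map_pmf (\<lambda>zs. zs ! length ys) (cond_pmf D {zs. strict_prefix ys zs}) = M (c @ ys)"
proof (rule pmf_eqI)
  fix x
  let ?A = "{zs. strict_prefix ys zs}"
  have ne: "set_pmf D \<inter> ?A \<noteq> {}"
    using pos by (metis measure_pmf_zero_iff less_irrefl)
  have "strict_prefix ys zs \<and> zs ! length ys = x \<longleftrightarrow> prefix (ys @ [x]) zs" for zs
    by (auto simp: prefix_def intro: strict_prefixI' elim!: strict_prefixE')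
  then have eq: "?A \<inter> (\<lambda>zs. zs ! length ys) -` {x} = {zs. prefix (ys @ [x]) zs}"
    by auto
  have "measure_pmf.prob D {zs. prefix (ys @ [x]) zs} = measure_pmf.prob D ?A * pmf (M (c @ ys)) x"
    using assms(1)
    by (simp add: follows_def measure_pmf.emeasure_eq_measure flip: ennreal_mult)
  then show "pmf (map_pmf (\<lambda>zs. zs ! length ys) (cond_pmf D ?A)) x = pmf (M (c @ ys)) x"
    using pos ne
    by (simp add: pmf_map cond_pmf.rep_eq measure_uniform_measure measure_pmf.emeasure_eq_measure eq)
qed


subsection \<open>Verification\<close>

primrec next_dists :: "'v language_model \<Rightarrow> 'v list \<Rightarrow> 'v list \<Rightarrow> 'v pmf list" where
  "next_dists M c [] = []"
| "next_dists M c (x # xs) = M c # next_dists M (c @ [x]) xs"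

lemma next_dists_append:
  "next_dists M c (xs @ ys) = next_dists M c xs @ next_dists M (c @ xs) ys"
  by (induction xs arbitrary: c) auto

text \<open>Verification trusts the reported distributions, so tokens of the right law do not
  suffice for passing to the next level: the reported list must also consist of the next-token laws
  of \<open>M\<close> along those tokens.\<close>

definition faithful :: "'v language_model \<Rightarrow> 'v list \<Rightarrow> ('v list \<times> 'v pmf list) pmf \<Rightarrow> bool" where
  "faithful M c D \<longleftrightarrow>
     (\<forall>(xs, qs) \<in> set_pmf D. qs = next_dists M c xs) \<and> follows M c (map_pmf fst D)"

lemma faithful_return_Nil: "faithful M c (return_pmf ([], []))"
  by (simp add: faithful_def follows_return_Nil)

lemma faithful_singleton: "faithful M c (map_pmf (\<lambda>x. ([x], [M c])) (M c))"
  using follows_singleton by (auto simp: faithful_def pmf.map_comp comp_def)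

lemma faithful_bind_append:
  assumes D: "faithful M c D"
    and E: "\<And>xs qs. (xs, qs) \<in> set_pmf D \<Longrightarrow> faithful M (c @ xs) (E xs)"
  shows "faithful M c (do {
     (xs, qs) \<leftarrow> D;
     (ys, ps) \<leftarrow> E xs;
     return_pmf (xs @ ys, qs @ ps)
   })" (is "faithful M c ?B")
proof -
  have "map_pmf fst ?B = bind_pmf (map_pmf fst D) (\<lambda>xs. map_pmf ((@) xs) (map_pmf fst (E xs)))"
    by (auto simp: map_bind_pmf bind_map_pmf map_pmf_def[of "(@) _"] case_prod_beta bind_return_pmf
        intro!: bind_pmf_cong)
  moreover have "follows M c (bind_pmf (map_pmf fst D) (\<lambda>xs. map_pmf ((@) xs) (map_pmf fst (E xs))))"
    using D E by (intro follows_bind_append) (auto simp: faithful_def)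
  ultimately show ?thesis
    using D E by (fastforce simp: faithful_def next_dists_append)
qed

lemma verify_Nil: "verify M [] [] c = map_pmf (\<lambda>m. ([m], [M c])) (M c)"
  by (simp add: verify_def map_pmf_def bind_return_pmf)

text \<open>Shifting the first draft token into the context turns the batch of tests into a
  recursion, which opens verification to induction over lists.\<close>

lemma verify_Cons:
  "verify M (x # xs) (q # qs) c = do {
     accepted \<leftarrow> accept_test (M c) q x;
     if accepted then map_pmf (\<lambda>(ys, ps). (x # ys, M c # ps)) (verify M xs qs (c @ [x]))
     else map_pmf (\<lambda>m. ([m], [M c])) (residual (M c) q)
   }"
proof -
  have ps: "map (\<lambda>i. M (c @ take i (x # xs))) [0..<Suc (Suc (length xs))] =
     M c # map (\<lambda>i. M ((c @ [x]) @ take i xs)) [0..<Suc (length xs)]"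
    by (subst upt_conv_Cons) (auto simp: simp del: upt_Suc simp flip: map_Suc_upt)
  show ?thesis
    unfolding verify_def Let_def list.size(4) add_0_right add_Suc_right ps
    by (auto simp: bind_assoc_pmf bind_return_pmf map_pmf_def simp del: upt_Suc
        intro!: bind_pmf_cong split: if_splits)
qed

text \<open>After a rejection the law reported for the last token is that of \<open>M\<close>, not
  the residual it was drawn from. This lets the output serve as a draft for the next level.\<close>

lemma verify_dists:
  "(ys, ps) \<in> set_pmf (verify M xs (next_dists N c xs) c) \<Longrightarrow> ps = next_dists M c ys"
proof (induction xs arbitrary: c ys ps)
  case Nil
  then show ?case by (auto simp: verify_Nil)
next
  case (Cons x xs)
  then show ?case by (auto simp: verify_Cons split: if_splits)
qed

text \<open>The probability that a drafted \<open>ys\<close> passes all its tests. It does not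
  depend on the rest of the draft and so factors out of the average over drafts.\<close>

primrec acceptance :: "'v language_model \<Rightarrow> 'v language_model \<Rightarrow> 'v list \<Rightarrow> 'v list \<Rightarrow> ennreal" where
  "acceptance M N c [] = 1"
| "acceptance M N c (y # ys) =
     ennreal (pmf (accept_test (M c) (N c) y) True) * acceptance M N (c @ [y]) ys"

lemma map_fst_verify_Cons:
  "map_pmf fst (verify M (x # xs) (q # qs) c) = do {
     accepted \<leftarrow> accept_test (M c) q x;
     if accepted then map_pmf ((#) x) (map_pmf fst (verify M xs qs (c @ [x])))
     else map_pmf (\<lambda>m. [m]) (residual (M c) q)
   }"
  by (auto simp: verify_Cons map_bind_pmf pmf.map_comp comp_def case_prod_beta intro!: bind_pmf_cong)

lemma emeasure_map_Cons_strict_prefix: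
  "emeasure (map_pmf ((#) z) D) {zs. strict_prefix (y # ys) zs} =
     (if z = y then emeasure D {zs. strict_prefix ys zs} else 0)"
  by (auto simp: strict_prefix_def)

lemma emeasure_map_Cons_prefix:
  "emeasure (map_pmf ((#) z) D) {zs. prefix (y # ys) zs} =
     (if z = y then emeasure D {zs. prefix ys zs} else 0)"
  by auto

lemma emeasure_map_singleton_strict_prefix:
  "emeasure (map_pmf (\<lambda>m. [m]) D) {zs. strict_prefix (y # ys) zs} = 0"
proof -
  have "(\<lambda>m. [m]) -` {zs. strict_prefix (y # ys) zs} = {}"
    by (auto simp: strict_prefix_def)
  then show ?thesis by (simp del: vimage_Collect_eq)
qed

lemma emeasure_map_singleton_prefix:
  "emeasure (map_pmf (\<lambda>m. [m]) D) {zs. prefix (y # ys) zs} =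
     (if ys = [] then ennreal (pmf D y) else 0)"
proof -
  have "(\<lambda>m. [m]) -` {zs. prefix (y # ys) zs} = (if ys = [] then {y} else {})"
    by auto
  then show ?thesis by (simp add: emeasure_pmf_single del: vimage_Collect_eq)
qed

text \<open>The one token not taken from the draft comes last. So an output going on beyond
  \<open>ys\<close> has \<open>ys\<close> as an accepted part of the draft, and an accepted
  \<open>ys\<close> is always followed by a further token.\<close>

lemma emeasure_verify_strict_prefix:
  "emeasure (map_pmf fst (verify M xs (next_dists N c xs) c)) {zs. strict_prefix ys zs} =
     acceptance M N c ys * indicator {zs. prefix ys zs} xs"
proof (induction ys arbitrary: c xs)
  case Nil
  have "AE zs in map_pmf fst (verify M xs (next_dists N c xs) c). zs \<in> {zs. strict_prefix [] zs}"
    by (auto simp: AE_measure_pmf_iff strict_prefix_def dest: verify_nonempty)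
  then have "emeasure (map_pmf fst (verify M xs (next_dists N c xs) c)) {zs. strict_prefix [] zs} = 1"
    by (intro measure_pmf.emeasure_eq_1_AE) auto
  then show ?case by simp
next
  case (Cons y ys)
  show ?case
  proof (cases xs)
    case Nil
    then show ?thesis
      by (simp add: verify_Nil pmf.map_comp comp_def emeasure_map_singleton_strict_prefix
          del: emeasure_map_pmf)
  next
    case (Cons z zs)
    then show ?thesis
      using Cons.IH[where c="c @ [z]" and xs=zs]
      by (cases "y = z")
        (simp_all add: map_fst_verify_Cons emeasure_bind_bool emeasure_map_Cons_strict_prefix
          emeasure_map_singleton_strict_prefix mult.assoc indicator_def del: map_pmf_comp emeasure_map_pmf emeasure_bind_pmf)
  qed
qed

text \<open>Once \<open>ys\<close> is accepted, either the draft ends and the extra token comes from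
  \<open>M\<close>, or it continues with some \<open>z\<close> and a speculative step decides. At
  most one summand is nonzero; the sum over \<open>z\<close> makes the probabilities of drafting
  \<open>ys @ [z]\<close> appear on averaging.\<close>

lemma emeasure_verify_prefix_snoc:
  "emeasure (map_pmf fst (verify M xs (next_dists N c xs) c)) {zs. prefix (ys @ [x]) zs} =
     acceptance M N c ys * (indicator {ys} xs * ennreal (pmf (M (c @ ys)) x) +
       (\<Sum>z\<in>UNIV. indicator {zs. prefix (ys @ [z]) zs} xs *
          ennreal (pmf (speculative_step (M (c @ ys)) (N (c @ ys)) z) x)))"
proof (induction ys arbitrary: c xs)
  case Nil
  show ?case
  proof (cases xs)
    case Nil
    then show ?thesis
      by (simp add: verify_Nil pmf.map_comp comp_def emeasure_map_singleton_prefix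
          del: emeasure_map_pmf prefix_Cons)
  next
    case (Cons z zs)
    \<comment> \<open>If \<open>z\<close> is accepted, later tests cannot change the first token, so
      only the total mass 1 of the remaining verification enters.\<close>
    have "Collect (prefix []) = (UNIV :: 'a list set)" by auto
    then have "emeasure (map_pmf fst (verify M xs (next_dists N c xs) c)) {zs. prefix [x] zs} =
        ennreal (pmf (speculative_step (M c) (N c) z) x)"
      by (simp add: Cons map_fst_verify_Cons emeasure_bind_bool emeasure_map_Cons_prefix
          emeasure_map_singleton_prefix speculative_step_def pmf_bind_bool pmf_bool_False pmf_le_1
          measure_pmf.emeasure_space_1[simplified] ennreal_plus ennreal_mult ennreal_mult_eq_top_iff
          del: map_pmf_comp emeasure_map_pmf emeasure_bind_pmf prefix_Cons)
    moreover have "(\<Sum>z'\<in>UNIV. indicator {zs. prefix [z'] zs} xs * f z') = f z"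
      for f :: "'a \<Rightarrow> ennreal"
    proof -
      have "(\<Sum>z'\<in>UNIV. indicator {zs. prefix [z'] zs} xs * f z') = (\<Sum>z'\<in>UNIV. if z' = z then f z' else 0)"
        by (rule sum.cong) (auto simp: Cons indicator_def)
      then show ?thesis by simp
    qed
    ultimately show ?thesis by (simp add: Cons)
  qed
next
  case (Cons y ys)
  show ?case
  proof (cases xs)
    case Nil
    then show ?thesis
      by (simp add: verify_Nil pmf.map_comp comp_def emeasure_map_singleton_prefix
          del: emeasure_map_pmf prefix_Cons)
  next
    case (Cons z zs)
    then show ?thesis
      using Cons.IH[where c="c @ [z]" and xs=zs]
      by (cases "y = z") (simp_all add: map_fst_verify_Cons emeasure_bind_bool emeasure_map_Cons_prefix
          emeasure_map_singleton_prefix mult.assoc indicator_def del: map_pmf_comp emeasure_map_pmf emeasure_bind_pmf)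
  qed
qed

text \<open>Whether the draft stops at \<open>ys\<close> or goes on, the next token has law
  \<open>M (c @ ys)\<close>: directly in the first case, and in the second because the drafted token
  then has law \<open>N (c @ ys)\<close>, which makes the speculative draw exact.\<close>

lemma faithful_verify:
  fixes M N :: "'v::finite language_model"
  assumes D: "faithful N c D"
  shows "faithful M c (bind_pmf D (\<lambda>(xs, qs). verify M xs qs c))"
proof -
  define F where "F = map_pmf fst D"
  define V where "V xs = map_pmf fst (verify M xs (next_dists N c xs) c)" for xs
  have F: "follows N c F" using D by (simp add: faithful_def F_def)
  have "follows M c (bind_pmf F V)"
    unfolding follows_def
  proof (intro allI)
    fix ys x
    let ?p = "M (c @ ys)" and ?q = "N (c @ ys)"
    let ?e = "emeasure F {zs. strict_prefix ys zs}"
    let ?s = "\<lambda>z. ennreal (pmf (speculative_step ?p ?q z) x)"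
    have strict: "emeasure (bind_pmf F V) {zs. strict_prefix ys zs} =
        acceptance M N c ys * emeasure F {zs. prefix ys zs}"
      by (simp add: emeasure_bind_pmf V_def emeasure_verify_strict_prefix nn_integral_cmult
          del: map_pmf_comp emeasure_map_pmf)
    have "{zs. prefix ys zs} = {ys} \<union> {zs. strict_prefix ys zs}" by (auto simp: strict_prefix_def)
    then have split: "emeasure F {zs. prefix ys zs} = emeasure F {ys} + ?e"
      by (simp add: plus_emeasure)
    have "(\<Sum>z\<in>UNIV. ennreal (pmf ?q z) * ?s z) = ennreal (\<Sum>z\<in>UNIV. pmf ?q z * pmf (speculative_step ?p ?q z) x)"
      by (simp flip: ennreal_mult)
    also have "\<dots> = ennreal (pmf (bind_pmf ?q (speculative_step ?p ?q)) x)"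
      by (simp add: pmf_bind integral_measure_pmf[where A=UNIV])
    finally have spec: "(\<Sum>z\<in>UNIV. ennreal (pmf ?q z) * ?s z) = ennreal (pmf ?p x)"
      by (simp add: bind_speculative_step)
    define drafted where "drafted xs = (\<Sum>z\<in>UNIV. indicator {zs. prefix (ys @ [z]) zs} xs * ?s z)" for xs
    have drafted: "(\<integral>\<^sup>+xs. drafted xs \<partial>F) =
        (\<Sum>z\<in>UNIV. emeasure F {zs. prefix (ys @ [z]) zs} * ?s z)"
      unfolding drafted_def by (subst nn_integral_sum) (simp_all add: nn_integral_multc)
    have "emeasure (bind_pmf F V) {zs. prefix (ys @ [x]) zs} =
        acceptance M N c ys * (emeasure F {ys} * ennreal (pmf ?p x) +
          (\<Sum>z\<in>UNIV. emeasure F {zs. prefix (ys @ [z]) zs} * ?s z))"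
      unfolding emeasure_bind_pmf V_def emeasure_verify_prefix_snoc drafted[symmetric]
      by (simp add: nn_integral_cmult nn_integral_add nn_integral_multc flip: drafted_def)
    \<comment> \<open>The only use of the draft's law: given that it goes on after
      \<open>ys\<close>, its next token is distributed as \<open>?q\<close>.\<close>
    also have "(\<Sum>z\<in>UNIV. emeasure F {zs. prefix (ys @ [z]) zs} * ?s z) =
        ?e * (\<Sum>z\<in>UNIV. ennreal (pmf ?q z) * ?s z)"
      using F by (simp add: follows_def sum_distrib_left mult.assoc)
    finally show "emeasure (bind_pmf F V) {zs. prefix (ys @ [x]) zs} =
        emeasure (bind_pmf F V) {zs. strict_prefix ys zs} * ennreal (pmf ?p x)"
      unfolding strict split spec by (simp add: distrib_right mult.assoc)
  qed
  \<comment> \<open>On the support of \<open>D\<close> the reported distributions are those of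
    \<open>N\<close>, so verification becomes a function \<open>V\<close> of the tokens
    alone.\<close>
  moreover have "map_pmf fst (bind_pmf D (\<lambda>(xs, qs). verify M xs qs c)) = bind_pmf F V"
    using D by (auto simp: F_def V_def faithful_def map_bind_pmf bind_map_pmf intro!: bind_pmf_cong)
  ultimately show ?thesis
    using D by (fastforce simp: faithful_def dest: verify_dists)
qed


subsection \<open>The hierarchy\<close>

lemma faithful_autoregress: "faithful M c (autoregress M n c)"
proof (induction n arbitrary: c)
  case 0
  show ?case by (simp add: faithful_return_Nil)
next
  case (Suc n)
  have "faithful M c (do {
     (xs, qs) \<leftarrow> map_pmf (\<lambda>x. ([x], [M c])) (M c);
     (ys, ps) \<leftarrow> autoregress M n (c @ xs);
     return_pmf (xs @ ys, qs @ ps)})"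
    by (rule faithful_bind_append[OF faithful_singleton Suc.IH])
  then show ?case by (simp add: bind_map_pmf)
qed

text \<open>Tokens already produced move into the context, making the remaining rounds a fresh loop
  with a smaller target length. If \<open>us\<close> alone reaches \<open>T\<close>, truncated
  subtraction gives target 0 and both loops stop.\<close>

lemma hsd_loop_append:
  "hsd_loop M draft T c (us @ tokens) (ps @ probs) =
     map_pmf (\<lambda>(ys, qs). (us @ ys, ps @ qs))
       (hsd_loop M draft (T - length us) (c @ us) tokens probs)"
proof (induction "T - length (us @ tokens)" arbitrary: tokens probs rule: less_induct)
  case less
  show ?case
  proof (cases "length (us @ tokens) < T")
    case True
    have "hsd_loop M draft T c (us @ tokens @ ys) (ps @ probs @ rs) =
      map_pmf (\<lambda>(ys, qs). (us @ ys, ps @ qs))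
       (hsd_loop M draft (T - length us) (c @ us) (tokens @ ys) (probs @ rs))"
      if "(ys, rs) \<in> set_pmf (verify M xs qs d)" for ys rs xs qs d
      using less[of "tokens @ ys" "probs @ rs"] True verify_nonempty[OF that]
      by (cases ys) auto
    with True show ?thesis
      by (subst (1 2) hsd_loop.simps)
        (auto simp: map_bind_pmf case_prod_beta less_diff_conv add.commute intro!: bind_pmf_cong)
  next
    case False
    then show ?thesis
      by (subst (1 2) hsd_loop.simps) auto
  qed
qed

text \<open>A loop with positive target is one verified draft followed by a fresh loop. A round may
  add several tokens, hence strong induction on \<open>T\<close>; overshooting leaves target
  0.\<close>

lemma faithful_hsd_loop:
  assumes draft: "\<And>c. faithful N c (draft c)"
  shows "faithful M c (hsd_loop M draft T c [] [])"
proof (induction T arbitrary: c rule: less_induct)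
  case (less T)
  show ?case
  proof (cases T)
    case 0
    then show ?thesis by (simp add: hsd_loop.simps faithful_return_Nil)
  next
    case (Suc T')
    let ?D = "bind_pmf (draft c) (\<lambda>(xs, qs). verify M xs qs c)"
    have "faithful M c (do {
       (ys, ps) \<leftarrow> ?D;
       (zs, rs) \<leftarrow> hsd_loop M draft (T - length ys) (c @ ys) [] [];
       return_pmf (ys @ zs, ps @ rs)})"
    proof (rule faithful_bind_append)
      show "faithful M c ?D" by (rule faithful_verify) (rule draft)
      fix ys ps assume "(ys, ps) \<in> set_pmf ?D"
      then have "ys \<noteq> []" by (auto dest: verify_nonempty)
      with Suc show "faithful M (c @ ys) (hsd_loop M draft (T - length ys) (c @ ys) [] [])"
        by (intro less) auto
    qed
    also have "\<dots> = hsd_loop M draft T c [] []"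
      using hsd_loop_append[of M draft T c _ "[]" _ "[]"] Suc
      by (subst (2) hsd_loop.simps)
        (simp add: bind_assoc_pmf case_prod_unfold map_pmf_def)
    finally show ?thesis .
  qed
qed

lemma faithful_hsd: "k \<le> K \<Longrightarrow> faithful (\<M> k) c (hsd K \<M> T k c)"
\<comment> \<open>A loop requests drafts at growing contexts, so the hypothesis must cover every
  \<open>c\<close>.\<close>
proof (induction k arbitrary: c)
  case 0
  show ?case by (simp add: faithful_autoregress)
next
  case (Suc k)
  then show ?case
    by (auto intro: faithful_verify faithful_hsd_loop)
qed

theorem theorem2p1:
  fixes K :: nat
    and \<M> :: "nat \<Rightarrow> 'v::finite language_model"
    and T :: "nat \<Rightarrow> nat"
    and c ys :: "'v list"
    and i :: nat
  assumes "K \<ge> 1"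
    and "\<And>k. k < K \<Longrightarrow> T k > 0"
    and "i \<ge> 1"
    and "length ys = i - 1"
    and "measure_pmf.prob (hsd_output K \<M> T c) {zs. length zs \<ge> i \<and> take (i - 1) zs = ys} > 0"
  shows "map_pmf (\<lambda>zs. zs ! (i - 1))
           (cond_pmf (hsd_output K \<M> T c) {zs. length zs \<ge> i \<and> take (i - 1) zs = ys})
         = \<M> K (c @ ys)"
proof -
  \<comment> \<open>Tokens are counted from 1, so \<open>ys\<close> has length \<open>i - 1\<close>,
    and \<open>length zs \<ge> i\<close> excludes \<open>zs = ys\<close>.\<close>
  have "length zs \<ge> i \<and> take (i - 1) zs = ys \<longleftrightarrow> strict_prefix ys zs" for zs
  proof
    assume "length zs \<ge> i \<and> take (i - 1) zs = ys"
    with assms(3,4) show "strict_prefix ys zs"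
      by (auto simp: strict_prefix_def take_is_prefix)
  next
    assume "strict_prefix ys zs"
    with assms(3,4) show "length zs \<ge> i \<and> take (i - 1) zs = ys"
      using prefix_length_less[of ys zs] by (auto simp: strict_prefix_def prefix_def)
  qed
  moreover have "follows (\<M> K) c (hsd_output K \<M> T c)"
    using faithful_hsd[of K K \<M> c T] by (simp add: faithful_def hsd_output_def)
  ultimately show ?thesis
    using follows_imp_cond[of "\<M> K" c "hsd_output K \<M> T c" ys] assms(4,5) by simp
qed

end
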